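(* Let $(X,d)$ be a metric space, and consider on $X\times[0,\infty)$ the metric $d_\infty((x,t),(y,s))=\max\{d(x,y),|t-s|\}$. Let $\mathcal{B}:X\times[0,\infty)\to CLB(X)$ be given by $\mathcal{B}(x,t)=\overline{B}(x,t)$, where $CLB(X)$ carries the Hausdorff metric $H$. Then $(X,d)$ has the strong corona property if and only if $\mathcal{B}$ is a Lipschitz map.
   Context: For a metric space $(X,d)$, $\overline{B}(x,t)=\{y\in X: d(x,y)\le t\}$ denotes the closed ball with center $x$ and radius $t\ge 0$, and $d(y,A)=\inf_{a\in A}d(y,a)$ for nonempty $A\subset X$. $CLB(X)$ is the set of all nonempty closed bounded subsets of $X$, endowed with the Hausdorff metric $H(A,B)=\max\{\sup_{x\in A}d(x,B),\ \sup_{x\in B}d(x,A)\}$. $(X,d)$ has the strong corona property if there exists a constant $C>0$ such that for all $x,y\in X$ and all $t,\varepsilon>0$, the relation $d(x,y)\le t+\varepsilon$ implies $d(y,\overline{B}(x,t))\le C\varepsilon$. *)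

theory Defs
  imports "HOL-Analysis.Analysis"
begin

definition dist_to_set :: "'a metric \<Rightarrow> 'a \<Rightarrow> 'a set \<Rightarrow> real" where
  "dist_to_set m y A = (INF a\<in>A. mdist m y a)"

definition strong_corona :: "'a metric \<Rightarrow> bool" where
  "strong_corona m \<longleftrightarrow>
     (\<exists>C>0. \<forall>x\<in>mspace m. \<forall>y\<in>mspace m. \<forall>t>0. \<forall>\<epsilon>>0.
        mdist m x y \<le> t + \<epsilon> \<longrightarrow> dist_to_set m y (mcball_of m x t) \<le> C * \<epsilon>)"

definition CLB :: "'a metric \<Rightarrow> 'a set set" where
  "CLB m = {A. A \<noteq> {} \<and> closedin (mtopology_of m) A \<and>
               Metric_space.mbounded (mspace m) (mdist m) A}"

definition hausdorff_dist :: "'a metric \<Rightarrow> 'a set \<Rightarrow> 'a set \<Rightarrow> real" where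
  "hausdorff_dist m A B =
     max (SUP x\<in>A. dist_to_set m x B) (SUP x\<in>B. dist_to_set m x A)"

text \<open>The value 0 off the carrier is there only because the locale \<^locale>\<open>Metric_space\<close> asks for
  nonnegativity on the whole type, where the suprema and infima above may be meaningless.\<close>

definition hausdorff_metric :: "'a metric \<Rightarrow> 'a set metric" where
  "hausdorff_metric m =
     metric (CLB m, \<lambda>A B. if A \<in> CLB m \<and> B \<in> CLB m then hausdorff_dist m A B else 0)"

definition max_prod_metric :: "'a metric \<Rightarrow> 'b metric \<Rightarrow> ('a \<times> 'b) metric" where
  "max_prod_metric m1 m2 =
     metric (mspace m1 \<times> mspace m2, \<lambda>(x, t) (y, s). max (mdist m1 x y) (mdist m2 t s))"


text \<open>\<^const>\<open>metric\<close> is only meaningful on arguments that satisfy the metric axioms, so these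
  are proved for the two constructions above.\<close>

lemma Metric_space_max_prod:
  "Metric_space (mspace m1 \<times> mspace m2)
     (\<lambda>(x, t) (y, s). max (mdist m1 x y) (mdist m2 t s))"
proof
  fix p q r :: "'a \<times> 'b"
  show "0 \<le> (case p of (x, t) \<Rightarrow> \<lambda>(y, s). max (mdist m1 x y) (mdist m2 t s)) q"
    by (auto split: prod.splits simp: le_max_iff_disj)
  show "(case p of (x, t) \<Rightarrow> \<lambda>(y, s). max (mdist m1 x y) (mdist m2 t s)) q =
        (case q of (x, t) \<Rightarrow> \<lambda>(y, s). max (mdist m1 x y) (mdist m2 t s)) p"
    by (auto split: prod.splits simp: mdist_commute)
  assume p: "p \<in> mspace m1 \<times> mspace m2" and q: "q \<in> mspace m1 \<times> mspace m2"
  obtain x t y s where pq: "p = (x, t)" "q = (y, s)" by (metis surj_pair)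
  have nn: "0 \<le> mdist m1 x y" "0 \<le> mdist m2 t s" by simp_all
  have z: "mdist m1 x y = 0 \<longleftrightarrow> x = y" "mdist m2 t s = 0 \<longleftrightarrow> t = s"
    using p q pq by auto
  show "(case p of (x, t) \<Rightarrow> \<lambda>(y, s). max (mdist m1 x y) (mdist m2 t s)) q = 0 \<longleftrightarrow> p = q"
  proof -
    have "max (mdist m1 x y) (mdist m2 t s) = 0 \<longleftrightarrow> mdist m1 x y = 0 \<and> mdist m2 t s = 0"
      using nn by linarith
    then show ?thesis using z pq by simp
  qed
  assume r: "r \<in> mspace m1 \<times> mspace m2"
  obtain w u where rr: "r = (w, u)" by (metis surj_pair)
  have "mdist m1 x w \<le> mdist m1 x y + mdist m1 y w" "mdist m2 t u \<le> mdist m2 t s + mdist m2 s u"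
    using p q r pq rr by (auto intro: mdist_triangle)
  then show "(case p of (x, t) \<Rightarrow> \<lambda>(y, s). max (mdist m1 x y) (mdist m2 t s)) r \<le>
        (case p of (x, t) \<Rightarrow> \<lambda>(y, s). max (mdist m1 x y) (mdist m2 t s)) q +
        (case q of (x, t) \<Rightarrow> \<lambda>(y, s). max (mdist m1 x y) (mdist m2 t s)) r"
    using pq rr by (auto simp: max_def)
qed

lemma mspace_max_prod_metric [simp]:
  "mspace (max_prod_metric m1 m2) = mspace m1 \<times> mspace m2"
  by (simp add: max_prod_metric_def Metric_space.mspace_metric[OF Metric_space_max_prod])

lemma mdist_max_prod_metric [simp]:
  "mdist (max_prod_metric m1 m2) = (\<lambda>(x, t) (y, s). max (mdist m1 x y) (mdist m2 t s))"
  by (simp add: max_prod_metric_def Metric_space.mdist_metric[OF Metric_space_max_prod])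

lemma CLB_subset: "A \<in> CLB m \<Longrightarrow> A \<subseteq> mspace m"
  by (metis (mono_tags, lifting) CLB_def closedin_subset mem_Collect_eq topspace_mtopology_of)

lemma dist_to_set_lower: "a \<in> A \<Longrightarrow> dist_to_set m y A \<le> mdist m y a"
  unfolding dist_to_set_def by (rule cINF_lower) (auto intro!: bdd_belowI[of _ 0])

lemma dist_to_set_greatest:
  "A \<noteq> {} \<Longrightarrow> (\<And>a. a \<in> A \<Longrightarrow> c \<le> mdist m y a) \<Longrightarrow> c \<le> dist_to_set m y A"
  unfolding dist_to_set_def by (rule cINF_greatest)

lemma dist_to_set_nonneg: "A \<noteq> {} \<Longrightarrow> 0 \<le> dist_to_set m y A"
  by (rule dist_to_set_greatest) auto

lemma dist_to_set_less:
  assumes "A \<noteq> {}" "dist_to_set m y A < c"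
  shows "\<exists>a\<in>A. mdist m y a < c"
  using dist_to_set_greatest[of A c m y] assms by (meson linorder_not_le)

lemma bdd_above_dist_to_set:
  assumes "A \<in> CLB m" "B \<in> CLB m"
  shows "bdd_above ((\<lambda>x. dist_to_set m x B) ` A)"
proof -
  interpret Metric_space "mspace m" "mdist m" by simp
  obtain b where b: "b \<in> B" using assms by (auto simp: CLB_def)
  obtain x r where xr: "A \<subseteq> mcball x r" using assms by (auto simp: CLB_def mbounded_def)
  have "dist_to_set m a B \<le> r + mdist m x b" if "a \<in> A" for a
  proof -
    have "a \<in> mspace m" "x \<in> mspace m" "mdist m x a \<le> r" "b \<in> mspace m"
      using that xr b CLB_subset[OF assms(2)] by auto
    then have "mdist m a b \<le> r + mdist m x b"
      using triangle[of a x b] commute[of a x] by linarith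
    then show ?thesis using dist_to_set_lower[OF b, of m a] by linarith
  qed
  then show ?thesis by (rule bdd_aboveI2)
qed

lemma hausdorff_dist_upper:
  assumes "A \<in> CLB m" "B \<in> CLB m" "x \<in> A"
  shows "dist_to_set m x B \<le> hausdorff_dist m A B"
  using cSUP_upper[OF assms(3) bdd_above_dist_to_set[OF assms(1,2)]]
  by (auto simp: hausdorff_dist_def)

lemma hausdorff_dist_commute: "hausdorff_dist m A B = hausdorff_dist m B A"
  by (simp add: hausdorff_dist_def max.commute)

lemma hausdorff_dist_least:
  assumes "A \<noteq> {}" "B \<noteq> {}"
    and "\<And>x. x \<in> A \<Longrightarrow> dist_to_set m x B \<le> c" "\<And>x. x \<in> B \<Longrightarrow> dist_to_set m x A \<le> c"
  shows "hausdorff_dist m A B \<le> c"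
  unfolding hausdorff_dist_def using assms by (auto intro!: cSUP_least)

lemma CLB_nonempty: "A \<in> CLB m \<Longrightarrow> A \<noteq> {}"
  by (simp add: CLB_def)

lemma hausdorff_dist_nonneg:
  assumes "A \<in> CLB m" "B \<in> CLB m"
  shows "0 \<le> hausdorff_dist m A B"
proof -
  obtain a where "a \<in> A" using CLB_nonempty[OF assms(1)] by blast
  then show ?thesis
    using hausdorff_dist_upper[OF assms] dist_to_set_nonneg[OF CLB_nonempty[OF assms(2)]]
    by (meson order_trans)
qed

lemma dist_to_set_zero_imp_in:
  assumes "B \<in> CLB m" "x \<in> mspace m" "dist_to_set m x B \<le> 0"
  shows "x \<in> B"
proof (rule ccontr)
  interpret Metric_space "mspace m" "mdist m" by simp
  assume n: "x \<notin> B"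
  have "closedin mtopology B" using assms(1) by (simp add: CLB_def mtopology_of_def)
  then obtain r where r: "r > 0" "disjnt B (mball x r)"
    using n assms(2) unfolding closedin_metric by blast
  obtain b where "b \<in> B" "mdist m x b < r"
    using dist_to_set_less[OF CLB_nonempty[OF assms(1)], of m x r] assms(3) r(1) by auto
  then show False using r(2) assms(2) CLB_subset[OF assms(1)] by (auto simp: disjnt_iff)
qed

lemma dist_to_set_hausdorff_triangle:
  assumes A: "A \<in> CLB m" and B: "B \<in> CLB m" and C: "C \<in> CLB m" and x: "x \<in> A"
  shows "dist_to_set m x C \<le> hausdorff_dist m A B + hausdorff_dist m B C"
proof (rule field_le_epsilon)
  interpret Metric_space "mspace m" "mdist m" by simp
  fix e :: real assume e: "e > 0"
  have "dist_to_set m x B < hausdorff_dist m A B + e / 2"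
    using hausdorff_dist_upper[OF A B x] e by linarith
  then obtain b where b: "b \<in> B" "mdist m x b < hausdorff_dist m A B + e / 2"
    using dist_to_set_less[OF CLB_nonempty[OF B]] by blast
  have "dist_to_set m b C < hausdorff_dist m B C + e / 2"
    using hausdorff_dist_upper[OF B C b(1)] e by linarith
  then obtain c where c: "c \<in> C" "mdist m b c < hausdorff_dist m B C + e / 2"
    using dist_to_set_less[OF CLB_nonempty[OF C]] by blast
  have "mdist m x c \<le> mdist m x b + mdist m b c"
    using x b(1) c(1) CLB_subset[OF A] CLB_subset[OF B] CLB_subset[OF C] by (intro triangle) auto
  then show "dist_to_set m x C \<le> hausdorff_dist m A B + hausdorff_dist m B C + e"
    using dist_to_set_lower[OF c(1), of m x] b(2) c(2) by linarith
qed

lemma Metric_space_hausdorff: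
  "Metric_space (CLB m) (\<lambda>A B. if A \<in> CLB m \<and> B \<in> CLB m then hausdorff_dist m A B else 0)"
proof
  fix A B C :: "'a set"
  let ?d = "\<lambda>A B. if A \<in> CLB m \<and> B \<in> CLB m then hausdorff_dist m A B else 0"
  show "0 \<le> ?d A B" by (simp add: hausdorff_dist_nonneg)
  show "?d A B = ?d B A" by (simp add: hausdorff_dist_commute)
  assume A: "A \<in> CLB m" and B: "B \<in> CLB m"
  have sub: "A' \<subseteq> B'" if "A' \<in> CLB m" "B' \<in> CLB m" "hausdorff_dist m A' B' = 0" for A' B'
    using that hausdorff_dist_upper[OF that(1,2)] dist_to_set_zero_imp_in[OF that(2)]
      CLB_subset[OF that(1)] by fastforce
  have refl: "hausdorff_dist m A A = 0"
  proof (rule antisym)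
    have "dist_to_set m x A \<le> 0" if "x \<in> A" for x
    proof -
      have "x \<in> mspace m" using that CLB_subset[OF A] by blast
      then have "mdist m x x = 0" by (rule Metric_space.mdist_zero[OF Metric_space_mspace_mdist])
      then show ?thesis using dist_to_set_lower[OF that, of m x] by linarith
    qed
    then show "hausdorff_dist m A A \<le> 0"
      by (intro hausdorff_dist_least CLB_nonempty[OF A])
    show "0 \<le> hausdorff_dist m A A" by (rule hausdorff_dist_nonneg[OF A A])
  qed
  show "?d A B = 0 \<longleftrightarrow> A = B"
    using sub[OF A B] sub[OF B A] refl A B by (auto simp: hausdorff_dist_commute)
  assume C: "C \<in> CLB m"
  have "hausdorff_dist m A C \<le> hausdorff_dist m A B + hausdorff_dist m B C"
    using dist_to_set_hausdorff_triangle[OF A B C] dist_to_set_hausdorff_triangle[OF C B A]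
    by (intro hausdorff_dist_least CLB_nonempty[OF A] CLB_nonempty[OF C])
      (auto simp: hausdorff_dist_commute add.commute)
  then show "?d A C \<le> ?d A B + ?d B C" using A B C by simp
qed

lemma mspace_hausdorff_metric [simp]: "mspace (hausdorff_metric m) = CLB m"
  by (simp add: hausdorff_metric_def Metric_space.mspace_metric[OF Metric_space_hausdorff])

lemma mdist_hausdorff_metric:
  "A \<in> CLB m \<Longrightarrow> B \<in> CLB m \<Longrightarrow> mdist (hausdorff_metric m) A B = hausdorff_dist m A B"
  by (simp add: hausdorff_metric_def Metric_space.mdist_metric[OF Metric_space_hausdorff])

lemma mcball_of_in_CLB: "x \<in> mspace m \<Longrightarrow> 0 \<le> t \<Longrightarrow> mcball_of m x t \<in> CLB m"
proof -
  assume x: "x \<in> mspace m" and t: "0 \<le> t"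
  interpret Metric_space "mspace m" "mdist m" by simp
  show ?thesis
    using x t by (auto simp: CLB_def mtopology_of_def mcball_of_def mcball_eq_empty mbounded_def)
qed

end

theory Submission
  imports Defs
begin

lemma mdist_self: "x \<in> mspace m \<Longrightarrow> mdist m x x = 0"
  by (rule Metric_space.mdist_zero[OF Metric_space_mspace_mdist])

lemma dist_to_set_le_0: "y \<in> mspace m \<Longrightarrow> y \<in> A \<Longrightarrow> dist_to_set m y A \<le> 0"
  using dist_to_set_lower[of y A m y] by (simp add: mdist_self)

lemma in_mcball_of_iff:
  "y \<in> mcball_of m x t \<longleftrightarrow> x \<in> mspace m \<and> y \<in> mspace m \<and> mdist m x y \<le> t"
  by (simp add: mcball_of_def Metric_space.in_mcball)

text \<open>The corona inequality is only assumed for positive radii; at radius \<open>0\<close> the centre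
  of the ball serves as the nearby point, which costs the constant \<open>1\<close>.\<close>

lemma dist_to_set_mcball_of_le:
  assumes C: "C \<ge> 1"
    and corona: "\<And>x y t \<epsilon>. x \<in> mspace m \<Longrightarrow> y \<in> mspace m \<Longrightarrow> t > 0 \<Longrightarrow> \<epsilon> > 0 \<Longrightarrow>
      mdist m x y \<le> t + \<epsilon> \<Longrightarrow> dist_to_set m y (mcball_of m x t) \<le> C * \<epsilon>"
    and x: "x \<in> mspace m" and y: "y \<in> mspace m"
    and nonneg: "0 \<le> t" "0 \<le> \<epsilon>" and le: "mdist m x y \<le> t + \<epsilon>"
  shows "dist_to_set m y (mcball_of m x t) \<le> C * \<epsilon>"
proof -
  have C\<epsilon>: "\<epsilon> \<le> C * \<epsilon>" using C nonneg by (simp add: mult_le_cancel_right1)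
  consider "\<epsilon> = 0" | "t = 0" | "t > 0" "\<epsilon> > 0" using nonneg by linarith
  then show ?thesis
  proof cases
    \<comment> \<open>Here \<open>y\<close> already lies in the ball, so its distance to the ball is
      at most \<open>0\<close>; this case also covers a ball of radius \<open>0\<close>.\<close>
    case 1
    then show ?thesis
      using dist_to_set_le_0[of y m "mcball_of m x t"] x y le by (simp add: in_mcball_of_iff)
  next
    case 2
    have "x \<in> mcball_of m x t" using x nonneg by (simp add: in_mcball_of_iff mdist_self)
    then have "dist_to_set m y (mcball_of m x t) \<le> mdist m y x" by (rule dist_to_set_lower)
    then show ?thesis using 2 le C\<epsilon> by (simp add: mdist_commute)
  next
    case 3
    then show ?thesis using corona x y le by blast
  qed
qed

theorem theorem2:
  fixes m :: "'a metric"
  shows "strong_corona m \<longleftrightarrow>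
    Lipschitz_continuous_map
      (max_prod_metric m (submetric euclidean_metric {0::real..}))
      (hausdorff_metric m)
      (\<lambda>(x, t). mcball_of m x t)"
proof -
  \<comment> \<open>Closed balls of nonnegative radius lie in \<open>CLB m\<close>, so the map lands
    in the right space and only the inequality remains. The constant \<open>K\<close> carries no
    sign condition.\<close>
  have lipschitz_iff: "Lipschitz_continuous_map
      (max_prod_metric m (submetric euclidean_metric {0::real..}))
      (hausdorff_metric m) (\<lambda>(x, t). mcball_of m x t) \<longleftrightarrow>
    (\<exists>K. \<forall>x\<in>mspace m. \<forall>y\<in>mspace m. \<forall>t\<ge>0. \<forall>s\<ge>0.
      hausdorff_dist m (mcball_of m x t) (mcball_of m y s) \<le> K * max (mdist m x y) \<bar>t - s\<bar>)"
    (is "_ \<longleftrightarrow> ?R")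
    by (auto simp: Lipschitz_continuous_map_def mcball_of_in_CLB mdist_hausdorff_metric dist_real_def
        Ball_def) blast+
  have "strong_corona m \<longleftrightarrow> ?R"
  proof
    assume "strong_corona m"
    then obtain C0 where C0: "\<And>x y t \<epsilon>. x \<in> mspace m \<Longrightarrow> y \<in> mspace m \<Longrightarrow> t > 0 \<Longrightarrow> \<epsilon> > 0 \<Longrightarrow>
      mdist m x y \<le> t + \<epsilon> \<Longrightarrow> dist_to_set m y (mcball_of m x t) \<le> C0 * \<epsilon>"
      unfolding strong_corona_def by blast
    \<comment> \<open>Enlarging the constant keeps the corona inequality, since \<epsilon> is
      positive, and gives the bound \<open>C \<ge> 1\<close> on which the extension to radius
      \<open>0\<close> relies.\<close>
    define C where "C = max C0 1"
    have C: "C \<ge> 1" by (simp add: C_def)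
    have corona: "dist_to_set m y (mcball_of m x t) \<le> C * \<epsilon>"
      if "x \<in> mspace m" "y \<in> mspace m" "t > 0" "\<epsilon> > 0" "mdist m x y \<le> t + \<epsilon>" for x y t \<epsilon>
    proof -
      have "C0 * \<epsilon> \<le> C * \<epsilon>" using that(4) by (intro mult_right_mono) (auto simp: C_def)
      then show ?thesis using C0[OF that] by linarith
    qed
    \<comment> \<open>A point of the first ball exceeds the radius \<open>s\<close> around
      \<open>y\<close> by at most \<open>2 * D\<close>: one \<open>D\<close> pays for moving the
      centre, the other for changing the radius. The corona inequality with excess
      \<open>2 * D\<close> then applies; both \<open>s\<close> and \<open>D\<close> may vanish,
      hence its extended form.\<close>
    have one_sided: "dist_to_set m z (mcball_of m y s) \<le> 2 * C * max (mdist m x y) \<bar>t - s\<bar>"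
      if x: "x \<in> mspace m" and y: "y \<in> mspace m" and s: "0 \<le> s"
        and z: "z \<in> mcball_of m x t" for x y z t s
    proof -
      define D where "D = max (mdist m x y) \<bar>t - s\<bar>"
      have D: "0 \<le> D" "mdist m x y \<le> D" "t - s \<le> D"
        by (auto simp: D_def le_max_iff_disj)
      have z': "z \<in> mspace m" "mdist m x z \<le> t" using z by (simp_all add: in_mcball_of_iff)
      have "mdist m y z \<le> mdist m y x + mdist m x z" using x y z' by (intro mdist_triangle)
      also have "\<dots> \<le> s + 2 * D" using z'(2) D mdist_commute[of m y x] by linarith
      finally have "dist_to_set m z (mcball_of m y s) \<le> C * (2 * D)"
        using D(1) by (intro dist_to_set_mcball_of_le[OF C corona y z'(1) s]) auto
      then show ?thesis by (simp add: D_def mult_ac)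
    qed
    have "hausdorff_dist m (mcball_of m x t) (mcball_of m y s) \<le> 2 * C * max (mdist m x y) \<bar>t - s\<bar>"
      if "x \<in> mspace m" "y \<in> mspace m" "0 \<le> t" "0 \<le> s" for x y t s
      \<comment> \<open>The bound is symmetric in the two balls, so exchanging them controls the
        other supremum.\<close>
      using that one_sided[of x y s _ t] one_sided[of y x t _ s]
      by (intro hausdorff_dist_least CLB_nonempty[OF mcball_of_in_CLB])
        (auto simp: mdist_commute abs_minus_commute)
    then show ?R by blast
  next
    assume ?R
    then obtain K where K: "\<And>x y t s. x \<in> mspace m \<Longrightarrow> y \<in> mspace m \<Longrightarrow> 0 \<le> t \<Longrightarrow> 0 \<le> s \<Longrightarrow>
      hausdorff_dist m (mcball_of m x t) (mcball_of m y s) \<le> K * max (mdist m x y) \<bar>t - s\<bar>"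
      by blast
    \<comment> \<open>Compare the concentric balls of radii \<open>t + \<epsilon>\<close> and
      \<open>t\<close>: the first contains \<open>y\<close>, and the pairs (centre, radius) are
      exactly \<epsilon> apart. The maximum with \<open>1\<close> makes the constant positive, as
      \<open>K\<close> need not be.\<close>
    have "dist_to_set m y (mcball_of m x t) \<le> max K 1 * \<epsilon>"
      if x: "x \<in> mspace m" and y: "y \<in> mspace m" and t: "t > 0" and \<epsilon>: "\<epsilon> > 0"
        and le: "mdist m x y \<le> t + \<epsilon>" for x y t \<epsilon>
    proof -
      have "y \<in> mcball_of m x (t + \<epsilon>)" using x y le by (simp add: in_mcball_of_iff)
      then have "dist_to_set m y (mcball_of m x t)
          \<le> hausdorff_dist m (mcball_of m x (t + \<epsilon>)) (mcball_of m x t)"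
        using x t \<epsilon> by (intro hausdorff_dist_upper mcball_of_in_CLB) auto
      also have "\<dots> \<le> K * \<epsilon>" using K[OF x x, of "t + \<epsilon>" t] x t \<epsilon> by (simp add: mdist_self)
      also have "\<dots> \<le> max K 1 * \<epsilon>" using \<epsilon> by (intro mult_right_mono) auto
      finally show ?thesis .
    qed
    then show "strong_corona m"
      unfolding strong_corona_def by (intro exI[of _ "max K 1"]) auto
  qed
  then show ?thesis using lipschitz_iff by simp
qed

end
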